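(* Let $n,\ell,r \ge 0$, let $a_1 \le \cdots \le a_n$ be positive integers and $b_1,\dots,b_\ell, c_1,\dots,c_r$ nonnegative integers, and let $$G = \maltese_{a_1} + \cdots + \maltese_{a_n} + *L_{b_1} + \cdots + *L_{b_\ell} + *R_{c_1} + \cdots + *R_{c_r}$$ (an empty sum being $*L$). Then $o(G) = \mathcal{L}$ if $n = 0$ and $r$ is even; $o(G) = \mathcal{R}$ if $n = 0$ and $r$ is odd; $o(G) = \mathcal{N}$ if $n = 1$, or if $n \ge 2$ and $a_3 \oplus \cdots \oplus a_n \oplus b_1 \oplus \cdots \oplus b_\ell \oplus c_1 \oplus \cdots \oplus c_r \neq 0$; $o(G) = \mathcal{P}$ if $n \ge 2$ and $a_3 \oplus \cdots \oplus a_n \oplus b_1 \oplus \cdots \oplus b_\ell \oplus c_1 \oplus \cdots \oplus c_r = 0$ (for $n = 2$ the terms $a_3,\dots,a_n$ are absent).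
   Context: Positions are defined recursively: $*L$ and $*R$ are terminal positions; if $G_1,\dots,G_k$ ($k\ge 1$) are positions, then $\{G_1,\dots,G_k\}$ is a position with options $G_1,\dots,G_k$. All positions have finite game trees. Play: Left and Right move alternately, each choosing any option of the current position; when a terminal position is reached, Left wins if it is $*L$ and Right wins if it is $*R$. Disjunctive sum: $*L + *L = *R + *R = *L$, $*L + *R = *R + *L = *R$; if at least one of $G,H$ is non-terminal, $G+H$ has options all $G'+H$ ($G'$ an option of $G$) and all $G+H'$ ($H'$ an option of $H$). Outcome classes: $\mathcal{L}$ (Left wins moving first or second), $\mathcal{R}$ (Right wins moving first or second), $\mathcal{N}$ (first player wins), $\mathcal{P}$ (second player wins); $o(G)$ denotes the outcome class. Define $*L_0 = *L$, $*R_0 = *R$, and for $m \ge 1$, $*L_m = \{*L_{m-1}, \ldots, *L_0\}$, $*R_m = \{*R_{m-1}, \ldots, *R_0\}$, and $\maltese_m = \{*L_{m-1}, *R_{m-1}, \ldots, *L_0, *R_0\}$. The symbol $\oplus$ denotes bitwise XOR (nim-sum) of nonnegative integers. *)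

theory Defs
  imports "HOL-Library.FSet"
begin

text \<open>
  A position \<open>{G\<^sub>1, \<dots>, G\<^sub>k}\<close> is \<open>Node\<close> of its finite set of options. The datatype also contains
  \<open>Node {||}\<close>, which the requirement \<open>k \<ge> 1\<close> rules out; \<open>valid\<close> singles out the genuine positions.
\<close>

datatype position = StarL | StarR | Node "position fset"

inductive valid :: "position \<Rightarrow> bool" where
  "valid StarL"
| "valid StarR"
| "S \<noteq> {||} \<Longrightarrow> (\<And>G. G |\<in>| S \<Longrightarrow> valid G) \<Longrightarrow> valid (Node S)"

fun options :: "position \<Rightarrow> position fset" where
  "options StarL = {||}"
| "options StarR = {||}"
| "options (Node S) = S"

fun terminal :: "position \<Rightarrow> bool" where
  "terminal (Node S) = False"
| "terminal _ = True"

lemma size_option_less: "G' |\<in>| options G \<Longrightarrow> size G' < size G"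
proof (cases G)
  case (Node S)
  assume "G' |\<in>| options G"
  with Node have "G' \<in> fset S" by simp
  then have "Suc (size G') \<le> (\<Sum>x\<in>fset S. Suc (size x))"
    by (intro member_le_sum) auto
  with Node show ?thesis by simp
qed auto


subsection \<open>Play and outcomes\<close>

datatype player = Left | Right

fun opponent :: "player \<Rightarrow> player" where
  "opponent Left = Right"
| "opponent Right = Left"

text \<open>\<open>wins X p G\<close>: player \<open>X\<close> can force a win from \<open>G\<close> when player \<open>p\<close> is the next to move.\<close>

function wins :: "player \<Rightarrow> player \<Rightarrow> position \<Rightarrow> bool" where
  "wins X p StarL \<longleftrightarrow> X = Left"
| "wins X p StarR \<longleftrightarrow> X = Right"
| "wins X p (Node S) \<longleftrightarrow>
     (if p = X then \<exists>G\<in>fset S. wins X (opponent p) G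
      else \<forall>G\<in>fset S. wins X (opponent p) G)"
  by pat_completeness auto
termination
  by (relation "measure (\<lambda>(X, p, G). size G)") (auto intro: size_option_less[of _ "Node _", simplified])

lemma wins_Right_iff: "wins Right p G \<longleftrightarrow> \<not> wins Left p G"
proof (induction G arbitrary: p)
  case (Node S)
  have "wins Right (opponent p) G \<longleftrightarrow> \<not> wins Left (opponent p) G" if "G \<in> fset S" for G
    using Node.IH that by blast
  then show ?case by (cases p) (simp_all cong: ball_cong bex_cong)
qed simp_all

datatype outcome_class = \<L> | \<R> | \<N> | \<P>

definition outcome :: "position \<Rightarrow> outcome_class" where
  "outcome G =
     (if wins Left Left G \<and> wins Left Right G then \<L>
      else if wins Right Left G \<and> wins Right Right G then \<R>
      else if wins Left Left G \<and> wins Right Right G then \<N>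
      else \<P>)"

lemma outcome_iff:
  "outcome G = \<L> \<longleftrightarrow> wins Left Left G \<and> wins Left Right G"
  "outcome G = \<R> \<longleftrightarrow> wins Right Left G \<and> wins Right Right G"
  "outcome G = \<N> \<longleftrightarrow> wins Left Left G \<and> wins Right Right G"
  "outcome G = \<P> \<longleftrightarrow> wins Right Left G \<and> wins Left Right G"
  by (auto simp: outcome_def wins_Right_iff)


subsection \<open>Disjunctive sum\<close>

function gsum :: "position \<Rightarrow> position \<Rightarrow> position" where
  "gsum G H =
     (if terminal G \<and> terminal H then (if G = H then StarL else StarR)
      else Node ((\<lambda>G'. gsum G' H) |`| options G |\<union>| (\<lambda>H'. gsum G H') |`| options H))"
  by auto
termination
  by (relation "measure (\<lambda>(G, H). size G + size H)") (auto dest: size_option_less)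

declare gsum.simps [simp del]

lemma gsum_terminal: "terminal G \<Longrightarrow> terminal H \<Longrightarrow> gsum G H = (if G = H then StarL else StarR)"
  by (subst gsum.simps) simp

lemma gsum_nonterminal:
  "\<not> (terminal G \<and> terminal H) \<Longrightarrow>
     gsum G H = Node ((\<lambda>G'. gsum G' H) |`| options G |\<union>| (\<lambda>H'. gsum G H') |`| options H)"
  by (subst gsum.simps) (simp only: if_False)

lemma terminal_iff: "terminal G \<longleftrightarrow> G = StarL \<or> G = StarR"
  by (cases G) auto

lemma terminal_gsum: "terminal (gsum G H) \<longleftrightarrow> terminal G \<and> terminal H"
proof (cases "terminal G \<and> terminal H")
  case False
  then show ?thesis unfolding gsum_nonterminal[OF False] by simp
qed (simp add: gsum_terminal)

lemma options_gsum:
  "options (gsum G H) = (\<lambda>G'. gsum G' H) |`| options G |\<union>| (\<lambda>H'. gsum G H') |`| options H"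
proof (cases "terminal G \<and> terminal H")
  case False
  show ?thesis unfolding gsum_nonterminal[OF False] by simp
qed (auto simp: terminal_iff gsum_terminal)

lemma position_eqI:
  "\<not> terminal G \<Longrightarrow> \<not> terminal H \<Longrightarrow> options G = options H \<Longrightarrow> G = H"
  by (cases G; cases H) auto

lemma gsum_commute: "gsum G H = gsum H G"
proof (induction "size G + size H" arbitrary: G H rule: less_induct)
  case less
  show ?case
  proof (cases "terminal G \<and> terminal H")
    case True
    then show ?thesis by (auto simp: gsum_terminal)
  next
    case False
    have "gsum G' H = gsum H G'" if "G' |\<in>| options G" for G'
      using less size_option_less[OF that] by simp
    moreover have "gsum G H' = gsum H' G" if "H' |\<in>| options H" for H'
      using less size_option_less[OF that] by simp
    ultimately have "options (gsum G H) = options (gsum H G)"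
      by (auto simp: options_gsum cong: fimage_cong)
    with False show ?thesis by (intro position_eqI) (auto simp: terminal_gsum)
  qed
qed

lemma gsum_assoc: "gsum (gsum G H) K = gsum G (gsum H K)"
proof (induction "size G + size H + size K" arbitrary: G H K rule: less_induct)
  case less
  show ?case
  proof (cases "terminal G \<and> terminal H \<and> terminal K")
    case True
    then show ?thesis by (auto simp: terminal_iff gsum_terminal)
  next
    case False
    have "gsum (gsum G' H) K = gsum G' (gsum H K)" if "G' |\<in>| options G" for G'
      using less size_option_less[OF that] by simp
    moreover have "gsum (gsum G H') K = gsum G (gsum H' K)" if "H' |\<in>| options H" for H'
      using less size_option_less[OF that] by simp
    moreover have "gsum (gsum G H) K' = gsum G (gsum H K')" if "K' |\<in>| options K" for K'
      using less size_option_less[OF that] by simp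
    ultimately have "options (gsum (gsum G H) K) = options (gsum G (gsum H K))"
      by (simp add: options_gsum fimage_funion fimage_fimage funion_assoc cong: fimage_cong)
    with False show ?thesis by (intro position_eqI) (auto simp: terminal_gsum)
  qed
qed

lemma gsum_StarL: "gsum StarL G = G"
proof (induction G)
  case (Node S)
  then have "(\<lambda>H'. gsum StarL H') |`| S = S"
    by (auto cong: fimage_cong)
  then show ?case by (subst gsum_nonterminal) simp_all
qed (auto simp: gsum_terminal)

instantiation position :: comm_monoid_add
begin

definition zero_position :: position where "0 = StarL"

definition plus_position :: "position \<Rightarrow> position \<Rightarrow> position" where "G + H = gsum G H"

instance
proof
  fix a b c :: position
  show "a + b + c = a + (b + c)" by (simp add: plus_position_def gsum_assoc)
  show "a + b = b + a" by (simp add: plus_position_def gsum_commute)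
  show "0 + a = a" by (simp add: plus_position_def zero_position_def gsum_StarL)
qed

end

lemma plus_position_simps:
  "StarL + StarL = StarL"
  "StarR + StarR = StarL"
  "StarL + StarR = StarR"
  "StarR + StarL = StarR"
  "\<not> (terminal G \<and> terminal H) \<Longrightarrow>
     G + H = Node ((\<lambda>G'. G' + H) |`| options G |\<union>| (\<lambda>H'. G + H') |`| options H)"
  unfolding plus_position_def by (simp_all add: gsum_terminal, rule gsum_nonterminal, simp)

lemma valid_plus: "valid G \<Longrightarrow> valid H \<Longrightarrow> valid (G + H)"
proof (induction "size G + size H" arbitrary: G H rule: less_induct)
  case less
  have opt: "valid K'" if "K' |\<in>| options K" "valid K" for K K'
    using that(2,1) by cases auto
  have ne: "options K \<noteq> {||}" if "valid K" "\<not> terminal K" for K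
    using that by cases auto
  show ?case
  proof (cases "terminal G \<and> terminal H")
    case True
    then show ?thesis by (auto simp: terminal_iff plus_position_simps intro: valid.intros)
  next
    case False
    have "valid (G' + H)" if "G' |\<in>| options G" for G'
      using less opt[OF that] size_option_less[OF that] by simp
    moreover have "valid (G + H')" if "H' |\<in>| options H" for H'
      using less opt[OF that] size_option_less[OF that] by simp
    ultimately show ?thesis
      using False ne less.prems
      by (subst plus_position_simps(5)) (auto intro!: valid.intros)
  qed
qed


subsection \<open>The families of positions\<close>

fun starL :: "nat \<Rightarrow> position" where
  "starL 0 = StarL"
| "starL (Suc m) = Node (fset_of_list (map starL [0..<Suc m]))"

fun starR :: "nat \<Rightarrow> position" where
  "starR 0 = StarR"
| "starR (Suc m) = Node (fset_of_list (map starR [0..<Suc m]))"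

text \<open>Only meaningful for \<open>m \<ge> 1\<close>.\<close>

definition maltese :: "nat \<Rightarrow> position" where
  "maltese m = Node (fset_of_list (map starL [0..<m]) |\<union>| fset_of_list (map starR [0..<m]))"

lemma valid_starL: "valid (starL m)"
proof (induction m rule: less_induct)
  case (less m)
  show ?case
  proof (cases m)
    case 0
    then show ?thesis by (simp add: valid.intros)
  next
    case (Suc k)
    have "fset_of_list (map starL [0..<Suc k]) \<noteq> {||}" by simp
    moreover have "valid G" if "G |\<in>| fset_of_list (map starL [0..<Suc k])" for G
      using that less Suc by (auto simp: fset_of_list_elem simp del: upt_Suc)
    ultimately show ?thesis
      unfolding Suc starL.simps by (intro valid.intros)
  qed
qed

lemma valid_starR: "valid (starR m)"
proof (induction m rule: less_induct)
  case (less m)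
  show ?case
  proof (cases m)
    case 0
    then show ?thesis by (simp add: valid.intros)
  next
    case (Suc k)
    have "fset_of_list (map starR [0..<Suc k]) \<noteq> {||}" by simp
    moreover have "valid G" if "G |\<in>| fset_of_list (map starR [0..<Suc k])" for G
      using that less Suc by (auto simp: fset_of_list_elem simp del: upt_Suc)
    ultimately show ?thesis
      unfolding Suc starR.simps by (intro valid.intros)
  qed
qed

lemma valid_maltese: "m > 0 \<Longrightarrow> valid (maltese m)"
  unfolding maltese_def
  by (cases m) (auto simp: fset_of_list_elem valid_starL valid_starR intro!: valid.intros)

definition nim_sum :: "nat list \<Rightarrow> nat" where
  "nim_sum xs = foldr Bit_Operations.xor xs 0"

end

theory Submission
  imports Defs
begin

text \<open>
  Since \<open>*R\<^sub>m = *L\<^sub>m + *R\<close>, only the parity of the number of \<open>*R\<close> summands matters, and \<open>*L\<^sub>m\<close> behaves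
  as a nim heap. Whoever resolves the last \<open>\<maltese>\<close> chooses that parity and hence wins, so with two
  \<open>\<maltese>\<close>'s left nobody wants to touch either of them. Reserving the two smallest for this endgame,
  the game is nim on the remaining heaps: resolving a reserved \<open>\<maltese>\<close> trades the third smallest
  \<open>a\<^sub>3\<close> for some \<open>k < a\<^sub>2 \<le> a\<^sub>3\<close> in the nim sum, which is still a change of one heap.
\<close>

section \<open>Nim sums\<close>

text \<open>Comparison by the higher bits first, with the last bit as tie-break; it drives induction
  along binary digits.\<close>

lemma div_2_less_iff:
  fixes m n :: nat
  shows "m < n \<longleftrightarrow> m div 2 < n div 2 \<or> m div 2 = n div 2 \<and> even m \<and> odd n"
  by presburger

lemma xor_nat_div_2: "xor m n div 2 = xor (m div 2) (n div 2)" for m n :: nat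
  by (simp add: xor_nat_rec[of m n])

lemma xor_nat_self_left [simp]: "xor a (xor a b) = b" for a b :: nat
  by (simp flip: xor.assoc)

text \<open>At the highest bit where \<open>m\<close> and \<open>xor a b\<close> differ, the latter
  has a 1, so exactly one of \<open>a\<close>, \<open>b\<close> has a 1 there; that one is the heap
  that can be lowered to make the nim sum \<open>m\<close>.\<close>

lemma less_xor_nat_cases:
  fixes a b m :: nat
  assumes "m < xor a b"
  shows "xor m b < a \<or> xor m a < b"
  using assms
proof (induction m arbitrary: a b rule: less_induct)
  case (less m)
  from less.prems consider
      (div) "m div 2 < xor (a div 2) (b div 2)"
    | (eq) "m div 2 = xor (a div 2) (b div 2)" "even m" "odd (xor a b)"
    by (simp only: div_2_less_iff[of m] xor_nat_div_2) blast
  then show ?case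
  proof cases
    case div
    have "xor (m div 2) (b div 2) < a div 2 \<or> xor (m div 2) (a div 2) < b div 2"
    proof (cases "m = 0")
      case True
      then show ?thesis using div by (cases "a div 2" "b div 2" rule: linorder_cases) auto
    next
      case False
      then show ?thesis using div by (intro less.IH) simp_all
    qed
    then show ?thesis
      by (auto simp: div_2_less_iff[of "xor m b"] div_2_less_iff[of "xor m a"] xor_nat_div_2)
  next
    case eq
    \<comment> \<open>All higher bits agree, so the last bit decides: exactly one of
      \<open>a\<close>, \<open>b\<close> is odd, and that one drops.\<close>
    have "xor (m div 2) (b div 2) = a div 2" "xor (m div 2) (a div 2) = b div 2"
      unfolding eq by (simp_all add: ac_simps)
    then show ?thesis
      using eq by (auto simp: div_2_less_iff[of "xor m b"] div_2_less_iff[of "xor m a"]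
          xor_nat_div_2 even_xor_iff)
  qed
qed

lemma xor_left_cancel_nat: "xor a b = xor a c \<longleftrightarrow> b = c" for a b c :: nat
  by (metis xor_nat_self_left)

lemma nim_sum_Nil [simp]: "nim_sum [] = 0"
  and nim_sum_Cons [simp]: "nim_sum (x # xs) = xor x (nim_sum xs)"
  by (simp_all add: nim_sum_def)

lemma nim_sum_append [simp]: "nim_sum (xs @ ys) = xor (nim_sum xs) (nim_sum ys)"
  by (induction xs) (simp_all add: ac_simps)

text \<open>The winning move of nim, by playing the first heap against the nim sum of the rest. The
  lowered heap moves to the front, matching the description of options of a sum below.\<close>

lemma nim_sum_move:
  assumes "m < nim_sum xs"
  obtains us x vs k where "xs = us @ x # vs" "k < x" "nim_sum (k # us @ vs) = m"
proof -
  have "\<exists>us x vs k. xs = us @ x # vs \<and> k < x \<and> nim_sum (k # us @ vs) = m"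
    using assms
  proof (induction xs arbitrary: m)
    case (Cons y ys)
    from Cons.prems less_xor_nat_cases[of m y "nim_sum ys"]
    consider "xor m (nim_sum ys) < y" | "xor m y < nim_sum ys" by auto
    then show ?case
    proof cases
      case 1
      have "nim_sum (xor m (nim_sum ys) # [] @ ys) = m"
        by (simp add: xor.assoc)
      with 1 show ?thesis by (metis append_Nil)
    next
      case 2
      then obtain us x vs k where *: "ys = us @ x # vs" "k < x" "nim_sum (k # us @ vs) = xor m y"
        using Cons.IH by blast
      have "nim_sum (k # (y # us) @ vs) = xor y (nim_sum (k # us @ vs))"
        by (simp add: ac_simps)
      also have "\<dots> = m" by (simp add: *(3) ac_simps del: nim_sum_Cons)
      finally show ?thesis using * by (metis append_Cons)
    qed
  qed simp
  with that show thesis by blast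
qed

section \<open>Moves in a sum of positions\<close>

lemma option_plus_iff:
  "K |\<in>| options (G + H) \<longleftrightarrow>
     (\<exists>G'. G' |\<in>| options G \<and> K = G' + H) \<or> (\<exists>H'. H' |\<in>| options H \<and> K = G + H')"
  by (auto simp: plus_position_def options_gsum)

lemma terminal_plus [simp]: "terminal (G + H) \<longleftrightarrow> terminal G \<and> terminal H"
  by (simp add: plus_position_def terminal_gsum)

lemma option_sum_list_iff:
  "K |\<in>| options (\<Sum>x\<leftarrow>xs. f x) \<longleftrightarrow>
     (\<exists>us x vs H. xs = us @ x # vs \<and> H |\<in>| options (f x) \<and> K = H + (\<Sum>x\<leftarrow>us @ vs. f x))"
proof (induction xs arbitrary: K)
  case Nil
  then show ?case by (simp add: zero_position_def)
next
  case (Cons y ys)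
  show ?case (is "_ \<longleftrightarrow> ?R")
  proof
    assume "K |\<in>| options (\<Sum>x\<leftarrow>y # ys. f x)"
    then consider H where "H |\<in>| options (f y)" "K = H + (\<Sum>x\<leftarrow>ys. f x)"
      | H where "H |\<in>| options (\<Sum>x\<leftarrow>ys. f x)" "K = f y + H"
      by (auto simp: option_plus_iff)
    then show ?R
    proof cases
      case 1
      then show ?thesis by (intro exI[of _ "[]"]) auto
    next
      case 2
      then obtain us x vs H' where "ys = us @ x # vs" "H' |\<in>| options (f x)"
        "H = H' + (\<Sum>x\<leftarrow>us @ vs. f x)"
        using Cons.IH by blast
      with 2(2) show ?thesis by (intro exI[of _ "y # us"]) (auto simp: ac_simps)
    qed
  next
    assume ?R
    then obtain us x vs H where *: "y # ys = us @ x # vs" "H |\<in>| options (f x)"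
      "K = H + (\<Sum>x\<leftarrow>us @ vs. f x)" by blast
    show "K |\<in>| options (\<Sum>x\<leftarrow>y # ys. f x)"
    proof (cases us)
      case Nil
      with * show ?thesis by (auto simp: option_plus_iff)
    next
      case (Cons u us')
      with * have "H + (\<Sum>x\<leftarrow>us' @ vs. f x) |\<in>| options (\<Sum>x\<leftarrow>ys. f x)"
        by (subst Cons.IH) auto
      moreover have "K = f y + (H + (\<Sum>x\<leftarrow>us' @ vs. f x))"
        using * Cons by (simp add: ac_simps)
      ultimately show ?thesis by (auto simp: option_plus_iff)
    qed
  qed
qed

lemma terminal_sum_list: "terminal (\<Sum>x\<leftarrow>xs. f x) \<longleftrightarrow> (\<forall>x\<in>set xs. terminal (f x))"
  by (induction xs) (auto simp: zero_position_def)

lemma option_starL_iff: "K |\<in>| options (starL m) \<longleftrightarrow> (\<exists>k<m. K = starL k)"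
  by (cases m) (auto simp: fset_of_list_elem simp del: upt_Suc)

lemma option_starR_iff: "K |\<in>| options (starR m) \<longleftrightarrow> (\<exists>k<m. K = starR k)"
  by (cases m) (auto simp: fset_of_list_elem simp del: upt_Suc)

lemma terminal_starL [simp]: "terminal (starL m) \<longleftrightarrow> m = 0"
  by (cases m) auto

lemma terminal_starR [simp]: "terminal (starR m) \<longleftrightarrow> m = 0"
  by (cases m) auto

text \<open>\<open>StarR\<close> has no options, so by induction both sides have the same moves. It
  separates the nim heap from its parity.\<close>

lemma starR_eq: "starR m = starL m + StarR"
proof (induction m rule: less_induct)
  case (less m)
  show ?case
  proof (cases "m = 0")
    case True
    then show ?thesis by (simp add: plus_position_simps)
  next
    case False
    have "options (starR m) = options (starL m + StarR)"
      using less by (fastforce simp: option_plus_iff option_starL_iff option_starR_iff)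
    with False show ?thesis by (intro position_eqI) simp_all
  qed
qed

lemma option_maltese_iff:
  "K |\<in>| options (maltese m) \<longleftrightarrow> (\<exists>k<m. \<exists>s. terminal s \<and> K = starL k + s)"
proof -
  have "K |\<in>| options (maltese m) \<longleftrightarrow> (\<exists>k<m. K = starL k + StarL \<or> K = starL k + StarR)"
    by (auto simp: maltese_def fset_of_list_elem simp flip: zero_position_def starR_eq)
  then show ?thesis by (auto simp: terminal_iff)
qed

lemma terminal_maltese [simp]: "\<not> terminal (maltese m)"
  by (simp add: maltese_def)

text \<open>Terminal positions form a group of order two under addition, so only the parity of the
  number of \<open>StarR\<close> summands survives.\<close>

lemma sum_list_starR:
  "(\<Sum>x\<leftarrow>c. starR x) = (\<Sum>x\<leftarrow>c. starL x) + (if even (length c) then StarL else StarR)"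
proof (induction c)
  case Nil
  then show ?case by (simp add: zero_position_def plus_position_simps)
next
  case (Cons x c)
  define e where "e = (if even (length c) then StarL else StarR)"
  have "(\<Sum>x\<leftarrow>x # c. starR x) = starL x + StarR + ((\<Sum>x\<leftarrow>c. starL x) + e)"
    using Cons by (simp add: e_def starR_eq[of x])
  also have "\<dots> = (\<Sum>x\<leftarrow>x # c. starL x) + (StarR + e)"
    by (simp add: ac_simps)
  also have "StarR + e = (if even (length (x # c)) then StarL else StarR)"
    by (simp add: e_def plus_position_simps)
  finally show ?case .
qed

section \<open>Sums of nim heaps and malteses\<close>

text \<open>Normal form of the game: unresolved malteses, nim heaps, and a terminal position
  \<open>s\<close> recording the parity.\<close>

definition maltese_nim :: "nat list \<Rightarrow> nat list \<Rightarrow> position \<Rightarrow> position" where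
  "maltese_nim a d s = (\<Sum>x\<leftarrow>a. maltese x) + (\<Sum>x\<leftarrow>d. starL x) + s"

text \<open>Since terminal positions form a group, choosing the terminal summand of a resolved
  maltese amounts to choosing the new total parity \<open>t\<close> freely.\<close>

lemma option_maltese_nim_iff:
  assumes "terminal s"
  shows "K |\<in>| options (maltese_nim a d s) \<longleftrightarrow>
    (\<exists>us x vs k t. a = us @ x # vs \<and> k < x \<and> terminal t \<and> K = maltese_nim (us @ vs) (k # d) t) \<or>
    (\<exists>us x vs k. d = us @ x # vs \<and> k < x \<and> K = maltese_nim a (k # us @ vs) s)"
    (is "_ \<longleftrightarrow> ?A \<or> ?D")
proof -
  have "options s = {||}" using assms by (auto simp: terminal_iff)
  then have "K |\<in>| options (maltese_nim a d s) \<longleftrightarrow>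
      (\<exists>H. H |\<in>| options (\<Sum>x\<leftarrow>a. maltese x) \<and> K = H + ((\<Sum>x\<leftarrow>d. starL x) + s)) \<or>
      (\<exists>H. H |\<in>| options (\<Sum>x\<leftarrow>d. starL x) \<and> K = (\<Sum>x\<leftarrow>a. maltese x) + (H + s))"
    by (auto simp: maltese_nim_def option_plus_iff add.assoc)
  also have "(\<exists>H. H |\<in>| options (\<Sum>x\<leftarrow>d. starL x) \<and> K = (\<Sum>x\<leftarrow>a. maltese x) + (H + s)) \<longleftrightarrow> ?D"
  proof -
    have eq: "(\<Sum>x\<leftarrow>a. maltese x) + (starL k + (\<Sum>x\<leftarrow>us @ vs. starL x) + s) =
        maltese_nim a (k # us @ vs) s" for k us vs
      by (simp add: maltese_nim_def add.assoc)
    show ?thesis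
      unfolding option_sum_list_iff option_starL_iff eq[symmetric] by blast
  qed
  also have "(\<exists>H. H |\<in>| options (\<Sum>x\<leftarrow>a. maltese x) \<and> K = H + ((\<Sum>x\<leftarrow>d. starL x) + s)) \<longleftrightarrow> ?A"
  proof
    assume "\<exists>H. H |\<in>| options (\<Sum>x\<leftarrow>a. maltese x) \<and> K = H + ((\<Sum>x\<leftarrow>d. starL x) + s)"
    then obtain us x vs k t where "a = us @ x # vs" "k < x" "terminal t"
      "K = starL k + t + (\<Sum>x\<leftarrow>us @ vs. maltese x) + ((\<Sum>x\<leftarrow>d. starL x) + s)"
      by (auto simp: option_sum_list_iff option_maltese_iff)
    \<comment> \<open>The new total parity is the chosen summand plus the old
      \<open>s\<close>.\<close>
    with assms show ?A
      by (intro exI[of _ us] exI[of _ x] exI[of _ vs] exI[of _ k] exI[of _ "t + s"])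
        (auto simp: maltese_nim_def ac_simps)
  next
    assume ?A
    then obtain us x vs k t where *: "a = us @ x # vs" "k < x" "terminal t"
      "K = maltese_nim (us @ vs) (k # d) t" by blast
    \<comment> \<open>As \<open>s\<close> is its own inverse, the option with summand
      \<open>t + s\<close> produces total parity \<open>t\<close>.\<close>
    have "s + s = 0"
      using assms by (auto simp: terminal_iff plus_position_simps zero_position_def)
    then have ss: "s + (s + H) = H" for H
      by (simp flip: add.assoc)
    then have K: "K = starL k + (t + s) + (\<Sum>x\<leftarrow>us @ vs. maltese x) + ((\<Sum>x\<leftarrow>d. starL x) + s)"
      using *(4) by (simp add: maltese_nim_def ss ac_simps)
    have "starL k + (t + s) |\<in>| options (maltese x)"
      unfolding option_maltese_iff using assms *(2,3)
      by (intro exI[of _ k] exI[of _ "t + s"] conjI) simp_all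
    with K *(1) show "\<exists>H. H |\<in>| options (\<Sum>x\<leftarrow>a. maltese x) \<and> K = H + ((\<Sum>x\<leftarrow>d. starL x) + s)"
      unfolding option_sum_list_iff by blast
  qed
  finally show ?thesis by blast
qed

lemma terminal_maltese_nim:
  "terminal (maltese_nim a d s) \<longleftrightarrow> a = [] \<and> (\<forall>x\<in>set d. x = 0) \<and> terminal s"
  by (cases a) (simp_all add: maltese_nim_def terminal_sum_list zero_position_def)

section \<open>Outcomes with at most one maltese\<close>

lemma wins_opponent_iff: "wins (opponent X) p G \<longleftrightarrow> \<not> wins X p G"
  by (cases X) (simp_all add: wins_Right_iff)

lemma wins_mover_iff:
  "\<not> terminal G \<Longrightarrow> wins p p G \<longleftrightarrow> (\<exists>K. K |\<in>| options G \<and> wins p (opponent p) K)"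
  by (cases G) auto

lemma wins_nonmover_iff:
  "\<not> terminal G \<Longrightarrow> p \<noteq> X \<Longrightarrow> wins X p G \<longleftrightarrow> (\<forall>K. K |\<in>| options G \<longrightarrow> wins X (opponent p) K)"
  by (cases G) auto

text \<open>Without malteses the parity can no longer change, so every line of play ends in
  \<open>s\<close>.\<close>

lemma wins_nim:
  assumes "terminal s"
  shows "wins X p (maltese_nim [] d s) \<longleftrightarrow> wins X p s"
proof (induction "sum_list d" arbitrary: d p rule: less_induct)
  case less
  have s: "wins X q s \<longleftrightarrow> wins X p s" for q
    using assms by (auto simp: terminal_iff)
  show ?case
  proof (cases "\<forall>x\<in>set d. x = 0")
    case True
    then have "(\<Sum>x\<leftarrow>d. starL x) = 0"
      by (induction d) (simp_all add: zero_position_def plus_position_simps)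
    then show ?thesis by (simp add: maltese_nim_def)
  next
    case False
    then have nt: "\<not> terminal (maltese_nim [] d s)" by (simp add: terminal_maltese_nim)
    have opt: "wins X (opponent p) K \<longleftrightarrow> wins X p s" if "K |\<in>| options (maltese_nim [] d s)" for K
    proof -
      from that obtain us x vs k where "d = us @ x # vs" "k < x"
        "K = maltese_nim [] (k # us @ vs) s"
        using assms by (auto simp: option_maltese_nim_iff)
      then show ?thesis using less[of "k # us @ vs" "opponent p"] s[of "opponent p"] by simp
    qed
    \<comment> \<open>All options agree on the winner; a legal move must exist for the mover's
      existential to agree as well.\<close>
    from False obtain x where "x \<in> set d" "x > 0" by auto
    then have "\<exists>K. K |\<in>| options (maltese_nim [] d s)"
      unfolding option_maltese_nim_iff[OF assms] by (metis in_set_conv_decomp)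
    with opt show ?thesis
      using wins_mover_iff[OF nt, of p] wins_nonmover_iff[OF nt, of p X] by metis
  qed
qed

text \<open>The mover resolves the last maltese to an empty heap with the favourable parity, after
  which nothing can change the winner.\<close>

lemma mover_wins_single_maltese:
  assumes "x > 0" "terminal s"
  shows "wins p p (maltese_nim [x] d s)"
proof -
  define t where "t = (if p = Left then StarL else StarR)"
  have t: "terminal t" "wins p (opponent p) t" by (cases p; simp add: t_def)+
  have "maltese_nim [] (0 # d) t |\<in>| options (maltese_nim [x] d s)"
    unfolding option_maltese_nim_iff[OF assms(2)] using assms t
    by (intro disjI1 exI[of _ "[]"] exI[of _ x] exI[of _ 0] exI[of _ t]) simp
  moreover have "wins p (opponent p) (maltese_nim [] (0 # d) t)"
    using t by (simp add: wins_nim)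
  moreover have "\<not> terminal (maltese_nim [x] d s)" by (simp add: terminal_maltese_nim)
  ultimately show ?thesis by (auto simp: wins_mover_iff)
qed

section \<open>Outcomes with two or more malteses\<close>

text \<open>No resolution of a maltese preserves nim sum zero: the tail trades some heap for the
  strictly smaller \<open>k\<close>. Sortedness guarantees this when a reserved maltese is
  resolved.\<close>

lemma nim_sum_drop_maltese_move:
  assumes "sorted a" "a = us @ x # vs" "length a \<ge> 3" "k < x"
    and "nim_sum (drop 2 a @ d) = 0"
  shows "nim_sum (drop 2 (us @ vs) @ k # d) \<noteq> 0"
proof -
  \<comment> \<open>The heap lost from the tail: \<open>x\<close> itself, or the third smallest if \<open>x\<close> was reserved.\<close>
  obtain y where y: "k < y" "nim_sum (drop 2 a) = xor y (nim_sum (drop 2 (us @ vs)))"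
  proof (cases "length us < 2")
    case True
    obtain u v w ws where a: "a = u # v # w # ws"
      using assms(3) by (auto simp: numeral_3_eq_3 Suc_le_length_iff)
    from True consider "us = []" | u' where "us = [u']"
      by (cases us) auto
    then have "k < w \<and> nim_sum (drop 2 a) = xor w (nim_sum (drop 2 (us @ vs)))"
      by cases (use assms a in auto)
    then show thesis using that by blast
  next
    case False
    then show thesis using that[of x] assms(2,4) by (auto simp: ac_simps)
  qed
  have "xor (nim_sum (drop 2 (us @ vs) @ d)) y \<noteq> xor (nim_sum (drop 2 (us @ vs) @ d)) k"
    using y(1) by (simp add: xor_left_cancel_nat del: nim_sum_append)
  with y(2) assms(5) show ?thesis by (simp add: ac_simps)
qed

text \<open>Induction on the total size, which every move lowers because a maltese of index
  \<open>x\<close> becomes a heap \<open>k < x\<close>. Generalizing over \<open>p\<close> lets the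
  hypothesis speak about the opponent as mover.\<close>

lemma mover_wins_maltese_nim:
  assumes "sorted a" "\<forall>x\<in>set a. x > 0" "length a \<ge> 2" "terminal s"
  shows "wins p p (maltese_nim a d s) \<longleftrightarrow> nim_sum (drop 2 a @ d) \<noteq> 0"
  using assms
proof (induction "sum_list a + sum_list d" arbitrary: a d s p rule: less_induct)
  case less
  note opts = option_maltese_nim_iff[OF \<open>terminal s\<close>]
  have nt: "\<not> terminal (maltese_nim a d s)"
    using less.prems by (auto simp: terminal_maltese_nim)
  have iff: "wins p p (maltese_nim a d s) \<longleftrightarrow>
      (\<exists>K. K |\<in>| options (maltese_nim a d s) \<and> \<not> wins (opponent p) (opponent p) K)"
    by (simp add: wins_mover_iff[OF nt] wins_opponent_iff)
  \<comment> \<open>With at least three malteses, two remain after one is resolved, so the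
    hypothesis still applies.\<close>
  have IHa: "wins q q (maltese_nim (us @ vs) (k # d) t) \<longleftrightarrow>
      nim_sum (drop 2 (us @ vs) @ k # d) \<noteq> 0"
    if "a = us @ x # vs" "k < x" "terminal t" "length a \<ge> 3" for us x vs k t q
    using less.prems that by (intro less.hyps) (auto simp: sorted_append)
  have IHd: "wins q q (maltese_nim a (k # us @ vs) s) \<longleftrightarrow> nim_sum (drop 2 a @ k # us @ vs) \<noteq> 0"
    if "d = us @ x # vs" "k < x" for us x vs k q
    using less.prems that by (intro less.hyps) auto
  show ?case
  proof (cases "nim_sum (drop 2 a @ d) = 0")
    case True
    have "wins (opponent p) (opponent p) K" if "K |\<in>| options (maltese_nim a d s)" for K
      using that unfolding opts
    proof (elim disjE exE conjE)
      fix us x vs k t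
      assume *: "a = us @ x # vs" "k < x" "terminal t" "K = maltese_nim (us @ vs) (k # d) t"
      show ?thesis
      proof (cases "length a = 2")
        \<comment> \<open>Only one maltese is left, and the opponent wins by resolving it.\<close>
        case two: True
        then have "length (us @ vs) = Suc 0" using *(1) by simp
        then obtain y where "us @ vs = [y]" by (metis length_0_conv length_Suc_conv)
        moreover from this have "y \<in> set a" using *(1) by (cases us) auto
        ultimately show ?thesis
          using *(3,4) less.prems(2) mover_wins_single_maltese by simp
      next
        case False
        with less.prems(3) have "length a \<ge> 3" by simp
        with * True less.prems(1) show ?thesis
          using IHa nim_sum_drop_maltese_move by presburger
      qed
    next
      fix us x vs k
      assume *: "d = us @ x # vs" "k < x" "K = maltese_nim a (k # us @ vs) s"
      have "xor (nim_sum (drop 2 a @ us @ vs)) k \<noteq> xor (nim_sum (drop 2 a @ us @ vs)) x"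
        using *(2) by (simp add: xor_left_cancel_nat del: nim_sum_append)
      then have "nim_sum (drop 2 a @ k # us @ vs) \<noteq> nim_sum (drop 2 a @ d)"
        using *(1) by (simp add: ac_simps)
      with * True IHd show ?thesis by simp
    qed
    with iff True show ?thesis by blast
  next
    case False
    \<comment> \<open>The nim move to zero lowers either an unreserved maltese or a genuine heap,
      according to where \<open>x\<close> sits in the appended list.\<close>
    then obtain us x vs k where move: "drop 2 a @ d = us @ x # vs" "k < x"
      "nim_sum (k # us @ vs) = 0"
      using nim_sum_move[of 0 "drop 2 a @ d"] by (metis gr0I)
    have "\<exists>K. K |\<in>| options (maltese_nim a d s) \<and> \<not> wins (opponent p) (opponent p) K"
    proof (cases "length us < length (drop 2 a)")
      case True
      then obtain zs where zs: "drop 2 a = us @ zs" "zs @ d = x # vs"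
        using move(1) unfolding append_eq_append_conv2 by auto
      with True have "zs \<noteq> []" by auto
      with zs obtain ws where ws: "drop 2 a = us @ x # ws" "vs = ws @ d"
        by (cases zs) auto
      \<comment> \<open>The reserved pair \<open>take 2 a\<close> stays in place, so dropping two
        after the move removes the same pair. The parity is left at \<open>s\<close>.\<close>
      have a: "a = (take 2 a @ us) @ x # ws"
        using ws(1) append_take_drop_id[of 2 a] by simp
      have "length a \<ge> 3" using True by simp
      have "drop 2 ((take 2 a @ us) @ ws) = us @ ws"
        using less.prems(3) by simp
      then have "nim_sum (drop 2 ((take 2 a @ us) @ ws) @ k # d) = 0"
        using move(3) ws(2) by (simp add: ac_simps)
      then have "\<not> wins (opponent p) (opponent p) (maltese_nim ((take 2 a @ us) @ ws) (k # d) s)"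
        using IHa[OF a move(2) less.prems(4) \<open>length a \<ge> 3\<close>] by simp
      then show ?thesis unfolding opts using a move(2) less.prems(4) by blast
    next
      case False
      then obtain ws where ws: "d = ws @ x # vs" "us = drop 2 a @ ws"
        using move(1) unfolding append_eq_append_conv2 by (auto simp del: length_drop)
      have "nim_sum (drop 2 a @ k # ws @ vs) = 0"
        using move(3) ws(2) by (simp add: ac_simps)
      then have "\<not> wins (opponent p) (opponent p) (maltese_nim a (k # ws @ vs) s)"
        using IHd[OF ws(1) move(2)] by simp
      then show ?thesis unfolding opts using ws(1) move(2) by blast
    qed
    with iff False show ?thesis by blast
  qed
qed

theorem theorem3p6:
  fixes a b c :: "nat list" and n r :: nat and G :: position
  assumes "n = length a" and "r = length c"
    and "sorted a" and "\<forall>x \<in> set a. x > 0"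
    and "G = (\<Sum>x\<leftarrow>a. maltese x) + (\<Sum>x\<leftarrow>b. starL x) + (\<Sum>x\<leftarrow>c. starR x)"
  shows "(n = 0 \<and> even r \<longrightarrow> outcome G = \<L>) \<and>
    (n = 0 \<and> odd r \<longrightarrow> outcome G = \<R>) \<and>
    (n = 1 \<or> (n \<ge> 2 \<and> nim_sum (drop 2 a @ b @ c) \<noteq> 0) \<longrightarrow> outcome G = \<N>) \<and>
    (n \<ge> 2 \<and> nim_sum (drop 2 a @ b @ c) = 0 \<longrightarrow> outcome G = \<P>)"
proof -
  define s where "s = (if even r then StarL else StarR)"
  have s: "terminal s" by (simp add: s_def)
  \<comment> \<open>The heaps of the \<open>starR\<close> summands join those of \<open>b\<close>;
    their parity goes into \<open>s\<close>.\<close>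
  have G: "G = maltese_nim a (b @ c) s"
    using assms(2,5) by (simp add: maltese_nim_def s_def sum_list_starR add.assoc)
  have zero: "wins X p G \<longleftrightarrow> wins X p s" if "n = 0" for X p
    using that assms(1) s by (simp add: G wins_nim)
  have one: "wins p p G" if n: "n = 1" for p
  proof -
    obtain x where "a = [x]" using n assms(1) by (cases a) auto
    then show ?thesis using assms(4) s by (simp add: G mover_wins_single_maltese)
  qed
  \<comment> \<open>The criterion is the same for both movers, so the outcome can only be \<N> or
    \<P>.\<close>
  have two: "wins p p G \<longleftrightarrow> nim_sum (drop 2 a @ b @ c) \<noteq> 0" if "n \<ge> 2" for p
    using mover_wins_maltese_nim[OF assms(3,4) _ s] that assms(1) by (simp add: G)
  show ?thesis
  proof (intro conjI impI)
    show "outcome G = \<L>" if "n = 0 \<and> even r"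
      using that by (simp add: outcome_iff zero s_def)
    show "outcome G = \<R>" if "n = 0 \<and> odd r"
      using that by (simp add: outcome_iff zero s_def)
    show "outcome G = \<N>" if "n = 1 \<or> (n \<ge> 2 \<and> nim_sum (drop 2 a @ b @ c) \<noteq> 0)"
      unfolding outcome_iff using that one two by blast
    show "outcome G = \<P>" if "n \<ge> 2 \<and> nim_sum (drop 2 a @ b @ c) = 0"
      unfolding outcome_iff using that two[of Left] two[of Right] by (simp add: wins_Right_iff)
  qed
qed

end
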